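(* Let $K=\mathbb{R}$ or $K=\mathbb{C}$, $n\in\mathbb{Z}_{>0}$, and let $\varphi^{[n]}:\mathbb{R}^n\to K$ be an $n$-dimensional tensor product mother scaling function, with associated spaces $V_j$, $j\in\mathbb{Z}$. Then the following conditions hold: (MRA1.1) $V_j\subset V_{j+1}$ for all $j\in\mathbb{Z}$; (MRA1.4) for all $j\in\mathbb{Z}$ and all functions $f:\mathbb{R}^n\to K$: $f\in V_j\iff f(2\,\cdot)\in V_{j+1}$; (MRA1.5) for all $j\in\mathbb{Z}$, $k\in\mathbb{Z}^n$ and all functions $f:\mathbb{R}^n\to K$: $f\in V_j\iff f(\cdot-2^{-j}k)\in V_j$; (MRA1.6) $\varphi^{[n]}(k)=\delta_{k,0}$ for all $k\in\mathbb{Z}^n$.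
   Context: $\varphi:\mathbb{R}\to K$ is a compactly supported interpolating mother scaling function: it is continuous and compactly supported, $\varphi(k)=\delta_{k,0}$ for all $k\in\mathbb{Z}$, and $\varphi(x)=\sum_{k\in\mathbb{Z}}\varphi(k/2)\varphi(2x-k)$ for all $x\in\mathbb{R}$. The $n$-dimensional tensor product mother scaling function generated by $\varphi$ is $\varphi^{[n]}(x)=\prod_{i=1}^n\varphi(x_i)$, $x\in\mathbb{R}^n$. For $j\in\mathbb{Z}$, $$V_j=\Bigl\{x\mapsto\sum_{k\in\mathbb{Z}^n}a_k\,\varphi^{[n]}(2^jx-k)\ :\ (a_k)_{k}\in\ell^\infty(\mathbb{Z}^n,K)\Bigr\}$$ (the sum is pointwise, with finitely many nonzero terms at each $x$), equipped with the supremum norm. *)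

theory Defs
  imports "HOL-Analysis.Analysis"
begin

text \<open>
  The scalar field \<open>K\<close> is a type \<open>'k :: real_normed_field\<close>. Both \<open>real\<close> and \<open>complex\<close> are
  instances, and by the Gelfand-Mazur theorem they are the only ones up to isometric isomorphism,
  since the norm of this class is multiplicative. Dimension \<open>n\<close> is \<open>CARD('n)\<close> for a nonempty
  finite index type \<open>'n\<close>.

  In both infinite sums below, compactness of the support of \<open>\<phi>\<close> leaves only finitely many nonzero
  terms for each fixed \<open>x\<close>, so \<open>infsum\<close> is an ordinary finite sum.
\<close>

definition interpolating_mother_scaling_function ::
    "(real \<Rightarrow> 'k::real_normed_field) \<Rightarrow> bool" where
  "interpolating_mother_scaling_function \<phi> \<longleftrightarrow>
     continuous_on UNIV \<phi> \<and>
     compact (closure {x. \<phi> x \<noteq> 0}) \<and>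
     (\<forall>k::int. \<phi> (of_int k) = (if k = 0 then 1 else 0)) \<and>
     (\<forall>x. \<phi> x = (\<Sum>\<^sub>\<infinity>k::int. \<phi> (of_int k / 2) * \<phi> (2 * x - of_int k)))"

definition tensor_scaling_function ::
    "(real \<Rightarrow> 'k::real_normed_field) \<Rightarrow> real ^ 'n::finite \<Rightarrow> 'k" where
  "tensor_scaling_function \<phi> x = (\<Prod>i\<in>UNIV. \<phi> (x $ i))"

definition lattice_vec :: "int ^ 'n::finite \<Rightarrow> real ^ 'n" where
  "lattice_vec k = (\<chi> i. of_int (k $ i))"

definition V_space ::
    "(real ^ 'n::finite \<Rightarrow> 'k::real_normed_field) \<Rightarrow> int \<Rightarrow> (real ^ 'n \<Rightarrow> 'k) set" where
  "V_space \<Phi> j =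
     {(\<lambda>x. \<Sum>\<^sub>\<infinity>k. a k * \<Phi> (2 powi j *\<^sub>R x - lattice_vec k)) | a :: int ^ 'n \<Rightarrow> 'k.
        bounded (range a)}"

end

theory Submission imports Defs begin

text \<open>
  Scaling and translation invariance are changes of variable in the series defining \<^term>\<open>V_space \<Phi> j\<close>:
  dilating the argument by \<open>2\<close> raises the level by one with the same coefficients, and translating
  by \<open>2\<^sup>-\<^sup>j k\<close> shifts the coefficients by \<open>k\<close>. The values at lattice points are products of the values
  of \<open>\<phi>\<close> at integers.

  The inclusion of \<open>V\<^sub>j\<close> in \<open>V\<^sub>j\<^sub>+\<^sub>1\<close> comes from the refinement equation. As \<open>\<phi>\<close> has compact support,
  only finitely many numbers \<open>\<phi> (k / 2)\<close> are nonzero, so the equation for \<open>\<phi>\<close> is a finite sum;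
  multiplying out the product over the coordinates gives a finite refinement equation
  \<open>\<Phi> y = (\<Sum>m\<in>F. \<Phi> (m / 2) * \<Phi> (2 y - m))\<close> (\<open>tensor_refinement\<close>). Substituting it into a series with
  coefficients \<open>a\<close> writes that series as a sum over \<open>m \<in> F\<close> of series at level \<open>j + 1\<close>, the \<open>m\<close>-th of
  which has the entries of \<open>a\<close> spread over the coset \<open>2 \<int>\<^sup>n + m\<close>. The new coefficients stay bounded
  because \<open>F\<close> is finite (\<open>V_space_refine\<close>).
\<close>

lemma lattice_vec_add: "lattice_vec (k + l) = lattice_vec k + lattice_vec l"
  by (simp add: lattice_vec_def vec_eq_iff)

lemma V_spaceI:
  assumes "bounded (range a)" "\<And>x. f x = (\<Sum>\<^sub>\<infinity>k. a k * \<Phi> (2 powi j *\<^sub>R x - lattice_vec k))"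
  shows "f \<in> V_space \<Phi> j"
  unfolding V_space_def using assms by blast

lemma V_spaceE:
  assumes "f \<in> V_space \<Phi> j"
  obtains a where "bounded (range a)"
    "\<And>x. f x = (\<Sum>\<^sub>\<infinity>k. a k * \<Phi> (2 powi j *\<^sub>R x - lattice_vec k))"
  using assms unfolding V_space_def by blast

section \<open>Dilations and translations\<close>

lemma V_space_dilate_iff:
  "f \<in> V_space \<Phi> j \<longleftrightarrow> (\<lambda>x. f (2 *\<^sub>R x)) \<in> V_space \<Phi> (j + 1)"
proof
  assume "f \<in> V_space \<Phi> j"
  then obtain a where a: "bounded (range a)"
    "\<And>x. f x = (\<Sum>\<^sub>\<infinity>k. a k * \<Phi> (2 powi j *\<^sub>R x - lattice_vec k))"
    using V_spaceE by blast
  show "(\<lambda>x. f (2 *\<^sub>R x)) \<in> V_space \<Phi> (j + 1)"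
    by (rule V_spaceI[OF a(1)]) (simp add: a(2) power_int_add_1)
next
  assume "(\<lambda>x. f (2 *\<^sub>R x)) \<in> V_space \<Phi> (j + 1)"
  then obtain a where a: "bounded (range a)"
    "\<And>x. f (2 *\<^sub>R x) = (\<Sum>\<^sub>\<infinity>k. a k * \<Phi> (2 powi (j + 1) *\<^sub>R x - lattice_vec k))"
    by (rule V_spaceE) blast
  have "f x = (\<Sum>\<^sub>\<infinity>k. a k * \<Phi> (2 powi j *\<^sub>R x - lattice_vec k))" for x
    using a(2)[of "(1/2) *\<^sub>R x"] by (simp add: power_int_add_1)
  then show "f \<in> V_space \<Phi> j"
    by (rule V_spaceI[OF a(1)])
qed

lemma V_space_translate:
  assumes "f \<in> V_space \<Phi> j"
  shows "(\<lambda>x. f (x - 2 powi (- j) *\<^sub>R lattice_vec k)) \<in> V_space \<Phi> j"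
proof -
  obtain a where a: "bounded (range a)"
    "\<And>x. f x = (\<Sum>\<^sub>\<infinity>l. a l * \<Phi> (2 powi j *\<^sub>R x - lattice_vec l))"
    using assms V_spaceE by blast
  show ?thesis
  proof (rule V_spaceI[where a = "\<lambda>l. a (l - k)"])
    show "bounded (range (\<lambda>l. a (l - k)))"
      by (rule bounded_subset[OF a(1)]) auto
    fix x
    have "2 powi j *\<^sub>R (x - 2 powi (- j) *\<^sub>R lattice_vec k) - lattice_vec l
        = 2 powi j *\<^sub>R x - lattice_vec (l + k)" for l
      by (simp add: lattice_vec_add scaleR_diff_right power_int_minus)
    then have "f (x - 2 powi (- j) *\<^sub>R lattice_vec k)
        = (\<Sum>\<^sub>\<infinity>l. a l * \<Phi> (2 powi j *\<^sub>R x - lattice_vec (l + k)))"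
      by (simp add: a(2))
    also have "\<dots> = (\<Sum>\<^sub>\<infinity>l. a (l - k) * \<Phi> (2 powi j *\<^sub>R x - lattice_vec l))"
      by (rule infsum_reindex_bij_witness[of _ "\<lambda>l. l - k" "\<lambda>l. l + k"]) auto
    finally show "f (x - 2 powi (- j) *\<^sub>R lattice_vec k)
        = (\<Sum>\<^sub>\<infinity>l. a (l - k) * \<Phi> (2 powi j *\<^sub>R x - lattice_vec l))" .
  qed
qed

lemma V_space_translate_iff:
  "f \<in> V_space \<Phi> j \<longleftrightarrow> (\<lambda>x. f (x - 2 powi (- j) *\<^sub>R lattice_vec k)) \<in> V_space \<Phi> j"
proof
  assume "(\<lambda>x. f (x - 2 powi (- j) *\<^sub>R lattice_vec k)) \<in> V_space \<Phi> j"
  moreover have "lattice_vec (- k) = - lattice_vec k"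
    by (simp add: lattice_vec_def vec_eq_iff)
  ultimately show "f \<in> V_space \<Phi> j"
    using V_space_translate[of "\<lambda>x. f (x - 2 powi (- j) *\<^sub>R lattice_vec k)" \<Phi> j "- k"] by simp
qed (rule V_space_translate)

section \<open>Refinable functions generate nested spaces\<close>

lemma summable_on_finite_nonzero:
  fixes g :: "'a \<Rightarrow> 'b::{comm_monoid_add, topological_space}"
  assumes "finite {k \<in> A. g k \<noteq> 0}"
  shows "g summable_on A"
proof -
  have "g summable_on A \<longleftrightarrow> g summable_on {k \<in> A. g k \<noteq> 0}"
    by (rule summable_on_cong_neutral) auto
  then show ?thesis
    using assms by simp
qed

lemma infsum_finite_sum:
  fixes g :: "'a \<Rightarrow> 'b \<Rightarrow> 'c::{topological_comm_monoid_add, t2_space}"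
  assumes "\<And>m. m \<in> F \<Longrightarrow> g m summable_on A"
  shows "(\<Sum>\<^sub>\<infinity>k\<in>A. \<Sum>m\<in>F. g m k) = (\<Sum>m\<in>F. infsum (g m) A)"
proof -
  have "((\<lambda>k. \<Sum>m\<in>F. g m k) has_sum (\<Sum>m\<in>F. infsum (g m) A)) A"
    using assms by (induction F rule: infinite_finite_induct) (auto intro!: has_sum_add)
  then show ?thesis
    by (rule infsumI)
qed

text \<open>
  With the mask \<open>c\<close> on the finite set \<open>F\<close>, the new coefficient at \<open>l\<close> collects \<open>c m * a k\<close> over the
  representations \<open>l = 2 k + m\<close> with \<open>m \<in> F\<close>. For each \<open>m\<close> there is at most one such \<open>k\<close>, so the
  finitely many \<open>m\<close> bound the coefficient. Local finiteness of the translates of \<open>\<Phi>\<close> justifies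
  the interchange of the two sums.
\<close>

lemma V_space_refine:
  fixes \<Phi> :: "real ^ 'n::finite \<Rightarrow> 'k::real_normed_field"
  assumes fin: "\<And>y. finite {k. \<Phi> (y - lattice_vec k) \<noteq> 0}"
    and "finite F"
    and refine: "\<And>y. \<Phi> y = (\<Sum>m\<in>F. c m * \<Phi> (2 *\<^sub>R y - lattice_vec m))"
  shows "V_space \<Phi> j \<subseteq> V_space \<Phi> (j + 1)"
proof
  fix f assume "f \<in> V_space \<Phi> j"
  then obtain a where a: "bounded (range a)"
    "\<And>x. f x = (\<Sum>\<^sub>\<infinity>k. a k * \<Phi> (2 powi j *\<^sub>R x - lattice_vec k))"
    using V_spaceE by blast
  \<comment> \<open>\<open>s m\<close> is \<open>a\<close> transported to the coset \<open>2 \<int>\<^sup>n + m\<close>, the range of \<open>e m\<close>, and zero elsewhere.\<close>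
  define e where "e m k = k + k + m" for m k :: "int ^ 'n"
  have inj_e: "inj (e m)" for m
    by (auto simp: inj_on_def e_def vec_eq_iff)
  define s where "s m l = (if l \<in> range (e m) then a (inv (e m) l) else 0)" for m l
  have s_e: "s m (e m k) = a k" for m k
    by (simp add: s_def inj_e)
  obtain M where M: "\<And>k. norm (a k) \<le> M"
    using a(1) by (auto simp: bounded_iff)
  have norm_s: "norm (s m l) \<le> M" for m l
    using M order_trans[OF norm_ge_zero M] by (auto simp: s_def)
  show "f \<in> V_space \<Phi> (j + 1)"
  proof (rule V_spaceI[where a = "\<lambda>l. \<Sum>m\<in>F. c m * s m l"])
    have "norm (\<Sum>m\<in>F. c m * s m l) \<le> (\<Sum>m\<in>F. norm (c m) * M)" for l
      by (rule sum_norm_le) (simp add: norm_mult mult_left_mono norm_s)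
    then show "bounded (range (\<lambda>l. \<Sum>m\<in>F. c m * s m l))"
      unfolding bounded_iff by blast
    fix x :: "real ^ 'n"
    define z where "z = 2 powi (j + 1) *\<^sub>R x"
    have level: "2 *\<^sub>R (2 powi j *\<^sub>R x - lattice_vec k) - lattice_vec m = z - lattice_vec (e m k)"
      for k m
      by (simp add: z_def power_int_add_1) (simp add: e_def lattice_vec_def vec_eq_iff algebra_simps)
    have fin_e: "finite {k. \<Phi> (z - lattice_vec (e m k)) \<noteq> 0}" for m
      using finite_vimageI[OF fin[of z] inj_e[of m]] by (simp add: vimage_def)
    have sum1: "(\<lambda>k. c m * (a k * \<Phi> (z - lattice_vec (e m k)))) summable_on UNIV" for m
      by (rule summable_on_finite_nonzero) (rule finite_subset[OF _ fin_e[of m]], auto)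
    have sum2: "(\<lambda>l. c m * (s m l * \<Phi> (z - lattice_vec l))) summable_on UNIV" for m
      by (rule summable_on_finite_nonzero) (rule finite_subset[OF _ fin[of z]], auto)
    have coset: "(\<Sum>\<^sub>\<infinity>k. c m * (a k * \<Phi> (z - lattice_vec (e m k))))
        = (\<Sum>\<^sub>\<infinity>l. c m * (s m l * \<Phi> (z - lattice_vec l)))" for m
    proof -
      have "(\<Sum>\<^sub>\<infinity>k. c m * (a k * \<Phi> (z - lattice_vec (e m k))))
          = (\<Sum>\<^sub>\<infinity>l\<in>range (e m). c m * (s m l * \<Phi> (z - lattice_vec l)))"
        by (subst infsum_reindex[OF inj_e]) (simp add: o_def s_e)
      also have "\<dots> = (\<Sum>\<^sub>\<infinity>l. c m * (s m l * \<Phi> (z - lattice_vec l)))"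
        by (rule infsum_cong_neutral) (auto simp: s_def)
      finally show ?thesis .
    qed
    have "f x = (\<Sum>\<^sub>\<infinity>k. \<Sum>m\<in>F. c m * (a k * \<Phi> (z - lattice_vec (e m k))))"
      unfolding a(2)
      by (subst refine) (simp add: level sum_distrib_left mult.left_commute)
    also have "\<dots> = (\<Sum>m\<in>F. \<Sum>\<^sub>\<infinity>k. c m * (a k * \<Phi> (z - lattice_vec (e m k))))"
      by (rule infsum_finite_sum) (rule sum1)
    also have "\<dots> = (\<Sum>m\<in>F. \<Sum>\<^sub>\<infinity>l. c m * (s m l * \<Phi> (z - lattice_vec l)))"
      by (simp only: coset)
    also have "\<dots> = (\<Sum>\<^sub>\<infinity>l. \<Sum>m\<in>F. c m * (s m l * \<Phi> (z - lattice_vec l)))"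
      by (rule infsum_finite_sum[symmetric]) (rule sum2)
    also have "\<dots> = (\<Sum>\<^sub>\<infinity>l. (\<Sum>m\<in>F. c m * s m l) * \<Phi> (z - lattice_vec l))"
      by (simp add: sum_distrib_right mult.assoc)
    finally show "f x = (\<Sum>\<^sub>\<infinity>l. (\<Sum>m\<in>F. c m * s m l) * \<Phi> (2 powi (j + 1) *\<^sub>R x - lattice_vec l))"
      by (simp only: z_def)
  qed
qed

section \<open>Tensor products of compactly supported scaling functions\<close>

text \<open>
  Step \<open>r = 1 / 2\<close> makes the mask \<open>\<phi> (k / 2)\<close> finite, and \<open>r = - 1\<close> makes the family of integer
  translates locally finite.
\<close>

lemma finite_progression_in_support:
  fixes \<phi> :: "real \<Rightarrow> 'a::zero"
  assumes "bounded {x. \<phi> x \<noteq> 0}" "r \<noteq> 0"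
  shows "finite {k::int. \<phi> (y + r * of_int k) \<noteq> 0}"
proof -
  obtain R where R: "\<And>x. \<phi> x \<noteq> 0 \<Longrightarrow> \<bar>x\<bar> \<le> R"
    using assms(1) by (auto simp: bounded_iff)
  define N where "N = \<lceil>(R + \<bar>y\<bar>) / \<bar>r\<bar>\<rceil>"
  have "\<bar>k\<bar> \<le> N" if "\<phi> (y + r * of_int k) \<noteq> 0" for k
  proof -
    have "\<bar>r * of_int k\<bar> \<le> R + \<bar>y\<bar>"
      using R[OF that] by linarith
    then have "\<bar>of_int k\<bar> \<le> (R + \<bar>y\<bar>) / \<bar>r\<bar>"
      using assms(2) by (simp add: abs_mult pos_le_divide_eq mult.commute)
    then show ?thesis
      unfolding N_def by linarith
  qed
  then have "{k. \<phi> (y + r * of_int k) \<noteq> 0} \<subseteq> {-N..N}"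
    by (fastforce simp: abs_le_iff)
  then show ?thesis
    by (rule finite_subset) simp
qed

lemma bij_betw_vec_lambda_PiE:
  "bij_betw vec_lambda (PiE UNIV B) {v :: 'a ^ 'n::finite. \<forall>i. v $ i \<in> B i}"
  by (rule bij_betwI[where g = vec_nth]) auto

lemma finite_vec_of_finite_entries:
  assumes "\<And>i. finite (B i)"
  shows "finite {v :: 'a ^ 'n::finite. \<forall>i. v $ i \<in> B i}"
  using assms bij_betw_finite[OF bij_betw_vec_lambda_PiE, of B] by (simp add: finite_PiE)

lemma tensor_locally_finite:
  fixes y :: "real ^ 'n::finite" and \<phi> :: "real \<Rightarrow> 'k::real_normed_field"
  assumes "bounded {x. \<phi> x \<noteq> 0}"
  shows "finite {k. tensor_scaling_function \<phi> (y - lattice_vec k) \<noteq> 0}"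
proof -
  have "finite {k :: int ^ 'n. \<forall>i. k $ i \<in> {l. \<phi> (y $ i - of_int l) \<noteq> 0}}"
    using finite_progression_in_support[OF assms, of "-1"]
    by (intro finite_vec_of_finite_entries) simp
  then show ?thesis
    by (simp add: tensor_scaling_function_def lattice_vec_def)
qed

text \<open>
  Distributing the product over the coordinates turns the choice of one summand in each
  coordinate into the choice of one lattice vector with entries in \<open>B\<close>.
\<close>

lemma tensor_refinement:
  fixes y :: "real ^ 'n::finite" and \<phi> :: "real \<Rightarrow> 'k::real_normed_field"
  assumes "finite B"
    and refine: "\<And>x. \<phi> x = (\<Sum>k\<in>B. \<phi> (of_int k / 2) * \<phi> (2 * x - of_int k))"
  shows "tensor_scaling_function \<phi> y =
    (\<Sum>m | \<forall>i. m $ i \<in> B. tensor_scaling_function \<phi> ((1/2) *\<^sub>R lattice_vec m)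
       * tensor_scaling_function \<phi> (2 *\<^sub>R y - lattice_vec m))"
proof -
  have "tensor_scaling_function \<phi> y
      = (\<Prod>i\<in>UNIV. \<Sum>k\<in>B. \<phi> (of_int k / 2) * \<phi> (2 * y $ i - of_int k))"
    unfolding tensor_scaling_function_def using refine by (rule prod.cong[OF refl])
  also have "\<dots> = (\<Sum>p\<in>PiE UNIV (\<lambda>_. B).
      \<Prod>i\<in>UNIV. \<phi> (of_int (p i) / 2) * \<phi> (2 * y $ i - of_int (p i)))"
    using assms(1) by (intro prod_sum_PiE) auto
  also have "\<dots> = (\<Sum>m | \<forall>i. m $ i \<in> B.
      \<Prod>i\<in>UNIV. \<phi> (of_int (m $ i) / 2) * \<phi> (2 * y $ i - of_int (m $ i)))"
    by (subst sum.reindex_bij_betw[OF bij_betw_vec_lambda_PiE, symmetric]) simp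
  finally show ?thesis
    by (simp add: tensor_scaling_function_def lattice_vec_def prod.distrib)
qed

lemma interpolating_bounded_support:
  assumes "interpolating_mother_scaling_function \<phi>"
  shows "bounded {x. \<phi> x \<noteq> 0}"
  using assms unfolding interpolating_mother_scaling_function_def
  by (meson bounded_subset closure_subset compact_imp_bounded)

lemma interpolating_finite_refinement:
  assumes "interpolating_mother_scaling_function \<phi>"
  obtains B :: "int set" where "finite B"
    "\<And>x. \<phi> x = (\<Sum>k\<in>B. \<phi> (of_int k / 2) * \<phi> (2 * x - of_int k))"
proof
  let ?B = "{k::int. \<phi> (of_int k / 2) \<noteq> 0}"
  show fin: "finite ?B"
    using interpolating_bounded_support[OF assms] finite_progression_in_support[of \<phi> "1/2" 0] by simp
  show "\<phi> x = (\<Sum>k\<in>?B. \<phi> (of_int k / 2) * \<phi> (2 * x - of_int k))" for x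
  proof -
    have "\<phi> x = (\<Sum>\<^sub>\<infinity>k::int. \<phi> (of_int k / 2) * \<phi> (2 * x - of_int k))"
      using assms unfolding interpolating_mother_scaling_function_def by blast
    also have "\<dots> = (\<Sum>\<^sub>\<infinity>k\<in>?B. \<phi> (of_int k / 2) * \<phi> (2 * x - of_int k))"
      by (rule infsum_cong_neutral) auto
    finally show ?thesis
      using fin by simp
  qed
qed

lemma tensor_at_lattice:
  assumes "\<And>k::int. \<phi> (of_int k) = (if k = 0 then 1 else 0)"
  shows "tensor_scaling_function \<phi> (lattice_vec k) = (if k = 0 then 1 else 0)"
  by (auto simp: tensor_scaling_function_def lattice_vec_def assms vec_eq_iff)

theorem lemma6p4:
  fixes \<phi> :: "real \<Rightarrow> 'k::real_normed_field"
    and \<Phi> :: "real ^ 'n::finite \<Rightarrow> 'k"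
  assumes "interpolating_mother_scaling_function \<phi>"
    and "\<Phi> = tensor_scaling_function \<phi>"
  shows "(\<forall>j. V_space \<Phi> j \<subseteq> V_space \<Phi> (j + 1)) \<and>
         (\<forall>j f. f \<in> V_space \<Phi> j \<longleftrightarrow> (\<lambda>x. f (2 *\<^sub>R x)) \<in> V_space \<Phi> (j + 1)) \<and>
         (\<forall>j k f. f \<in> V_space \<Phi> j \<longleftrightarrow>
            (\<lambda>x. f (x - 2 powi (- j) *\<^sub>R lattice_vec k)) \<in> V_space \<Phi> j) \<and>
         (\<forall>k. \<Phi> (lattice_vec k) = (if k = 0 then 1 else 0))"
proof (intro conjI allI)
  obtain B :: "int set" where B: "finite B"
    "\<And>x. \<phi> x = (\<Sum>k\<in>B. \<phi> (of_int k / 2) * \<phi> (2 * x - of_int k))"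
    using interpolating_finite_refinement[OF assms(1)] by blast
  show "V_space \<Phi> j \<subseteq> V_space \<Phi> (j + 1)" for j
    unfolding assms(2)
  proof (rule V_space_refine)
    show "finite {m :: int ^ 'n. \<forall>i. m $ i \<in> B}"
      using B(1) by (rule finite_vec_of_finite_entries)
  qed (rule tensor_locally_finite[OF interpolating_bounded_support[OF assms(1)]], rule tensor_refinement[OF B])
  show "f \<in> V_space \<Phi> j \<longleftrightarrow> (\<lambda>x. f (2 *\<^sub>R x)) \<in> V_space \<Phi> (j + 1)" for j f
    by (rule V_space_dilate_iff)
  show "f \<in> V_space \<Phi> j \<longleftrightarrow> (\<lambda>x. f (x - 2 powi (- j) *\<^sub>R lattice_vec k)) \<in> V_space \<Phi> j" for j k f
    by (rule V_space_translate_iff)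
  show "\<Phi> (lattice_vec k) = (if k = 0 then 1 else 0)" for k
    using assms(1) unfolding assms(2) interpolating_mother_scaling_function_def
    by (intro tensor_at_lattice) blast
qed

end
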